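(* Let $S_2\subset\mathbb{R}$ contain all terms of a lacunary sequence $(d_j)_{j\ge1}\subset(0,\infty)$, of any ratio $q\in(0,1)$, with counting function $J(W)=\#\{j: d_j\ge e^{-W}\}$. Let $S_1\subset\mathbb{R}$ be infinite, and suppose some bounded interval $Q_0$ contains infinitely many points of $S_1$. Let $N$ be the packing function of $S_1$ in $Q_0$, i.e. for $W>0$ $$N(W)=\max\big\{\#U:\ U\subseteq S_1\cap Q_0,\ |u-u'|\ge 2e^{-W}\ \text{for all distinct } u,u'\in U\big\}.$$ If $$\limsup_{W\to\infty}\frac{\min\big(N(W),J(W)\big)\,J(W)}{W}=\infty,$$ then $S_1+S_2$ and $S_1-S_2$ are not measure universal.
   Context: A set $E\subset\mathbb{R}$ is measure universal if for every Lebesgue measurable $L\subset\mathbb{R}$ of positive Lebesgue measure there exist $x\in\mathbb{R}$ and $\lambda\neq0$ with $x+\lambda E\subset L$. A sequence $(d_j)_{j\ge1}\subset(0,\infty)$ is lacunary with ratio $q\in(0,1)$ if $d_{j+1}\le q\,d_j$ for all $j$. $S_1\pm S_2=\{s_1\pm s_2: s_1\in S_1,\ s_2\in S_2\}$. The counting function $J$ is defined for $W>0$; the packing function $N(W)$ is finite for each $W>0$ because $Q_0$ is bounded. *)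

theory Defs
  imports "HOL-Analysis.Analysis"
begin

definition measure_universal :: "real set \<Rightarrow> bool" where
  "measure_universal E \<longleftrightarrow>
     (\<forall>L \<in> sets lebesgue. emeasure lebesgue L > 0 \<longrightarrow>
        (\<exists>x c. c \<noteq> 0 \<and> (\<lambda>e. x + c * e) ` E \<subseteq> L))"

(* Sequences (d_j), j \<ge> 1, are functions on nat; the value at 0 is never used. *)
definition lacunary :: "real \<Rightarrow> (nat \<Rightarrow> real) \<Rightarrow> bool" where
  "lacunary q d \<longleftrightarrow> 0 < q \<and> q < 1 \<and> (\<forall>j\<ge>1. 0 < d j \<and> d (Suc j) \<le> q * d j)"

(* For lacunary d the set below is finite, so card is the true number of elements. *)
definition counting_fun :: "(nat \<Rightarrow> real) \<Rightarrow> real \<Rightarrow> nat" where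
  "counting_fun d W = card {j. j \<ge> 1 \<and> d j \<ge> exp (- W)}"

(* For bounded Q every separated U is finite and the cardinalities are bounded, so that Max
   is a genuine maximum (the empty U makes the set nonempty). *)
definition packing_fun :: "real set \<Rightarrow> real set \<Rightarrow> real \<Rightarrow> nat" where
  "packing_fun S Q W =
     Max {card U |U. U \<subseteq> S \<inter> Q \<and> finite U \<and>
            (\<forall>u\<in>U. \<forall>v\<in>U. u \<noteq> v \<longrightarrow> \<bar>u - v\<bar> \<ge> 2 * exp (- W))}"

end

theory Submission
  imports Defs
begin

text \<open>It suffices to find, for every bounded range of scales bounded away from 0, an open set of
small measure that meets every copy of E = S1 + \<sigma> S2 (with \<sigma> = 1 or -1) lying in the unit
interval: removing countably many such sets from the unit interval leaves positive measure. Cut the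
line into cells of length \<eta>, a small multiple of exp (-W). Up to an error of one cell there are only
polynomially many copies in 1/\<eta>, and if each of them meets at least k of the O(1/\<eta>) cells in the
unit interval, a greedy choice finds O(W/(\<eta> k)) cells hitting all copies; their total length
is O(W/k). The hypothesis makes k/W arbitrarily large: take A in S1 separated at scale exp (-W)
and a subsequence D of (d_j) with ratio at most 1/4, card A \<le> card D. A nonzero difference determines
the pair of elements of D it comes from, even approximately, so a + D and a' + D share at most one
cell when a \<noteq> a', and the copies of A + D meet at least card A * card D / 2 cells.\<close>

section \<open>Greedy hitting sets for families of large finite sets\<close>

text \<open>Double counting of pairs (point, unhit set) shows that some point of \<open>V\<close>
  lies in at least the proportion \<open>k / card V\<close> of the sets not yet hit. Adding that
  point to \<open>T\<close> multiplies the number of unhit sets by at most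
  \<open>1 - k / card V\<close>.\<close>

lemma greedy_hitting_set:
  fixes C :: "'i \<Rightarrow> 'v set"
  assumes "finite V" "V \<noteq> {}" "finite I"
    and C: "\<And>i. i \<in> I \<Longrightarrow> C i \<subseteq> V \<and> k \<le> real (card (C i))"
  shows "\<exists>T. T \<subseteq> V \<and> card T \<le> t \<and>
           real (card {i \<in> I. C i \<inter> T = {}}) \<le> real (card I) * (1 - k / card V) ^ t"
proof (induction t)
  case 0
  then show ?case by (intro exI[of _ "{}"]) auto
next
  case (Suc t)
  then obtain T where T: "T \<subseteq> V" "card T \<le> t"
    "real (card {i \<in> I. C i \<inter> T = {}}) \<le> real (card I) * (1 - k / card V) ^ t" by blast
  define R where "R = {i \<in> I. C i \<inter> T = {}}"
  define h where "h v = card {i \<in> R. v \<in> C i}" for v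
  have finR: "finite R" using assms(3) by (auto simp: R_def)
  have V0: "card V > 0" using assms by (simp add: card_gt_0_iff)
  have "(\<Sum>v\<in>V. h v) = (\<Sum>v\<in>V. \<Sum>i\<in>R. if v \<in> C i then 1 else 0)"
    unfolding h_def using finR by (intro sum.cong refl) (simp add: sum.If_cases Int_def)
  also have "\<dots> = (\<Sum>i\<in>R. \<Sum>v\<in>V. if v \<in> C i then 1 else 0)" by (rule sum.swap)
  also have "\<dots> = (\<Sum>i\<in>R. card (C i))"
    using assms(1) C by (intro sum.cong refl) (auto simp: sum.If_cases R_def Int_absorb1)
  finally have dc: "(\<Sum>v\<in>V. real (h v)) = (\<Sum>i\<in>R. real (card (C i)))"
    by (metis of_nat_sum)
  have "(\<Sum>i\<in>R. k) \<le> (\<Sum>i\<in>R. real (card (C i)))"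
    using C by (intro sum_mono) (auto simp: R_def)
  hence le: "k * card R \<le> (\<Sum>v\<in>V. real (h v))" using dc by (simp add: mult.commute)
  have "\<exists>v\<in>V. real (h v) \<ge> k * card R / card V"
  proof (rule ccontr)
    assume "\<not> ?thesis"
    hence "(\<Sum>v\<in>V. real (h v)) < (\<Sum>v\<in>V. k * card R / card V)"
      using assms by (intro sum_strict_mono) auto
    also have "\<dots> = k * card R" using V0 by simp
    finally show False using le by simp
  qed
  then obtain v where v: "v \<in> V" "real (h v) \<ge> k * card R / card V" by blast
  have kV: "1 - k / card V \<ge> 0" if "R \<noteq> {}"
  proof -
    from that obtain i where "i \<in> I" by (auto simp: R_def)
    then have "k \<le> card (C i)" "card (C i) \<le> card V"
      using C assms(1) by (auto intro: card_mono)
    then show ?thesis using V0 by (simp add: field_simps)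
  qed
  have sub: "{i \<in> I. C i \<inter> insert v T = {}} = R - {i \<in> R. v \<in> C i}" by (auto simp: R_def)
  have "real (card {i \<in> I. C i \<inter> insert v T = {}}) = card R - real (h v)"
    unfolding sub h_def using finR
    by (subst card_Diff_subset) (auto simp: of_nat_diff card_mono)
  also have "\<dots> \<le> card R * (1 - k / card V)" using v(2) by (simp add: algebra_simps)
  \<comment> \<open>Multiplying the induction hypothesis by \<open>1 - k / card V\<close> needs this
    factor to be nonnegative, which an unhit set guarantees. If nothing is unhit, the left side is 0
    and only the sign of the right side matters.\<close>
  also have "\<dots> \<le> real (card I) * (1 - k / card V) ^ t * (1 - k / card V)"
  proof (cases "R = {}")
    case True
    have "0 \<le> real (card I) * (1 - k / card V) ^ Suc t"
    proof (cases "I = {}")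
      case False
      then obtain i where "i \<in> I" by blast
      then have "k \<le> card (C i)" "card (C i) \<le> card V"
        using C assms(1) by (auto intro: card_mono)
      then have "k / card V \<le> 1" using V0 by (simp add: field_simps)
      then show ?thesis by simp
    qed simp
    then show ?thesis using True by (simp add: mult_ac)
  next
    case False
    then show ?thesis using T(3) kV by (intro mult_right_mono) (auto simp: R_def)
  qed
  finally show ?case using T v assms(1)
    by (intro exI[of _ "insert v T"]) (auto simp: mult_ac card_insert_if finite_subset)
qed

text \<open>Greedy selection is stopped at the first integer \<open>t\<close> strictly above
  \<open>card V * ln (card I) / k\<close>. Since \<open>1 - y \<le> exp (- y)\<close>, fewer than
  one set is then unhit, hence none.\<close>

lemma hitting_set_exists:
  fixes C :: "'i \<Rightarrow> 'v set"
  assumes "finite V" "V \<noteq> {}" "finite I" "I \<noteq> {}" "k > 0"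
    and C: "\<And>i. i \<in> I \<Longrightarrow> C i \<subseteq> V \<and> k \<le> real (card (C i))"
  shows "\<exists>T\<subseteq>V. real (card T) \<le> card V * ln (card I) / k + 2 \<and> (\<forall>i\<in>I. C i \<inter> T \<noteq> {})"
proof -
  define s where "s = card V * ln (card I) / k"
  define t where "t = nat \<lfloor>s\<rfloor> + 1"
  have I1: "real (card I) \<ge> 1" using assms by (simp add: Suc_le_eq card_gt_0_iff)
  have V0: "real (card V) > 0" using assms by (simp add: card_gt_0_iff)
  have s0: "s \<ge> 0" unfolding s_def using I1 V0 assms(5) by simp
  have ts: "s < real t" "real t \<le> s + 1" unfolding t_def using s0 by linarith+
  obtain T where T: "T \<subseteq> V" "card T \<le> t"
    "real (card {i \<in> I. C i \<inter> T = {}}) \<le> real (card I) * (1 - k / card V) ^ t"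
    using greedy_hitting_set[of V I C k t] assms by blast
  obtain i0 where "i0 \<in> I" using assms by blast
  then have "k \<le> card (C i0)" "card (C i0) \<le> card V"
    using C assms(1) by (auto intro: card_mono)
  then have kV: "1 - k / card V \<ge> 0" using V0 by (simp add: field_simps)
  have "(1 - k / card V) ^ t \<le> exp (- (k / card V)) ^ t"
    using kV exp_ge_add_one_self[of "- (k / card V)"] by (intro power_mono) auto
  also have "\<dots> = exp (- (k * t / card V))"
    by (simp add: exp_of_nat_mult[symmetric] algebra_simps)
  also have "\<dots> < exp (- ln (card I))"
  proof -
    have "k * s / card V = ln (card I)" using V0 assms(5) by (simp add: s_def)
    moreover have "k * s / card V < k * t / card V"
      using ts(1) V0 assms(5) by (intro divide_strict_right_mono mult_strict_left_mono) auto
    ultimately show ?thesis by simp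
  qed
  also have "\<dots> = 1 / card I" using I1 by (simp add: exp_minus inverse_eq_divide)
  finally have "real (card I) * (1 - k / card V) ^ t < 1" using I1 by (simp add: field_simps)
  then have "card {i \<in> I. C i \<inter> T = {}} = 0" using T(3) by linarith
  then have "\<forall>i\<in>I. C i \<inter> T \<noteq> {}" using assms(3) by auto
  moreover have "real (card T) \<le> s + 2" using T(2) ts(2) by linarith
  ultimately show ?thesis using T(1) unfolding s_def by blast
qed

section \<open>Discretization of affine copies\<close>

lemma card_floor_divide_le:
  fixes b s :: real
  assumes "s > 0" "b \<ge> 0"
  shows "finite ((\<lambda>x. \<lfloor>x / s\<rfloor>) ` {-b..b})"
    and "real (card ((\<lambda>x. \<lfloor>x / s\<rfloor>) ` {-b..b})) \<le> 2 * b / s + 2"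
proof -
  have sub: "(\<lambda>x. \<lfloor>x / s\<rfloor>) ` {-b..b} \<subseteq> {\<lfloor>-b / s\<rfloor>..\<lfloor>b / s\<rfloor>}"
    using assms divide_right_mono[of "-b" _ s] divide_right_mono[of _ b s]
    by (fastforce intro!: floor_mono)
  then show "finite ((\<lambda>x. \<lfloor>x / s\<rfloor>) ` {-b..b})" by (rule finite_subset) simp
  have "b / s \<ge> 0" using assms by simp
  have "card ((\<lambda>x. \<lfloor>x / s\<rfloor>) ` {-b..b}) \<le> card {\<lfloor>-b / s\<rfloor>..\<lfloor>b / s\<rfloor>}"
    using sub by (intro card_mono) auto
  also have "real \<dots> \<le> 2 * b / s + 2" using \<open>b / s \<ge> 0\<close> by simp linarith
  finally show "real (card ((\<lambda>x. \<lfloor>x / s\<rfloor>) ` {-b..b})) \<le> 2 * b / s + 2" by simp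
qed

text \<open>Rounding \<open>(x, c)\<close> to a grid leaves at most \<open>(B / \<eta>)^2\<close>
  classes of admissible copies, so the scale enters the hitting-set bound only through a logarithm.
  The cells come from \<open>F\<close> and not from \<open>E\<close>: the bound \<open>R\<close> on
  \<open>F\<close> is what controls the effect of rounding \<open>c\<close>, and \<open>E\<close>
  may be unbounded.\<close>

lemma affine_hitting_set:
  fixes E F :: "real set" and n R \<eta> k :: real
  assumes F: "F \<subseteq> E" "\<And>f. f \<in> F \<Longrightarrow> \<bar>f\<bar> \<le> R"
    and pos: "n \<ge> 1" "R \<ge> 0" "0 < \<eta>" "\<eta> \<le> 1" "k > 0"
    and cells: "\<And>x c. 1 / n \<le> \<bar>c\<bar> \<Longrightarrow> \<bar>c\<bar> \<le> n \<Longrightarrow>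
                  k \<le> real (card ((\<lambda>f. \<lfloor>(x + c * f) / \<eta>\<rfloor>) ` F))"
  defines "B \<equiv> 2 * (n + n * R) * (1 + R) + 2"
  shows "\<exists>G. open G \<and> emeasure lebesgue G \<le> ennreal (6 * \<eta> + 12 * ln (B / \<eta>) / k) \<and>
           (\<forall>x c. 1 / n \<le> \<bar>c\<bar> \<longrightarrow> \<bar>c\<bar> \<le> n \<longrightarrow> (\<lambda>e. x + c * e) ` E \<subseteq> {0..1} \<longrightarrow>
              (\<exists>e\<in>E. x + c * e \<in> G))"
proof -
  \<comment> \<open>With this mesh, changing \<open>x\<close> and \<open>c\<close> by less than
    \<open>s\<close> each moves \<open>x + c * f\<close> by less than
    \<open>s * (1 + R) = \<eta>\<close> whenever \<open>\<bar>f\<bar> \<le> R\<close>.\<close>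
  define s where "s = \<eta> / (1 + R)"
  have s: "s > 0" using pos by (simp add: s_def)
  define P where "P = {(x, c). 1 / n \<le> \<bar>c\<bar> \<and> \<bar>c\<bar> \<le> n \<and> (\<lambda>e. x + c * e) ` E \<subseteq> {0..1}}"
  define \<kappa> where "\<kappa> = (\<lambda>(x, c). (\<lfloor>x / s\<rfloor>, \<lfloor>c / s\<rfloor>))"
  define I where "I = \<kappa> ` P"
  \<comment> \<open>An admissible representative of each grid square, so that no rounding leaves the admissible range.\<close>
  define rep where "rep i = (SOME p. p \<in> P \<and> \<kappa> p = i)" for i
  define C where "C i = (case rep i of (x, c) \<Rightarrow> (\<lambda>f. \<lfloor>(x + c * f) / \<eta>\<rfloor>) ` F)" for i
  define V where "V = {0..\<lfloor>1 / \<eta>\<rfloor>}"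
  have B1: "B \<ge> 1" using pos by (simp add: B_def)
  have lnB: "ln (B / \<eta>) \<ge> 0" using B1 pos by (simp add: field_simps)
  show ?thesis
  proof (cases "P = {}")
    case True
    then show ?thesis using pos lnB by (intro exI[of _ "{}"]) (auto simp: P_def)
  next
    case False
    have rep: "rep i \<in> P \<and> \<kappa> (rep i) = i" if "i \<in> I" for i
      unfolding rep_def by (rule someI_ex) (use that in \<open>auto simp: I_def\<close>)
    have F0: "F \<noteq> {}"
    proof
      assume "F = {}"
      then show False using cells[of 1] pos by simp
    qed
    \<comment> \<open>One point of \<open>F\<close> landing in the unit interval forces
      \<open>\<bar>x\<bar> \<le> 1 + n * R\<close>, and \<open>\<bar>c\<bar> \<le> n\<close>. The
      common bound \<open>n + n * R\<close> covers both coordinates.\<close>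
    have sub: "I \<subseteq> ((\<lambda>x. \<lfloor>x / s\<rfloor>) ` {-(n + n * R)..n + n * R}) \<times>
                   ((\<lambda>x. \<lfloor>x / s\<rfloor>) ` {-(n + n * R)..n + n * R})"
    proof
      fix i assume "i \<in> I"
      then obtain x c where xc: "(x, c) \<in> P" "i = (\<lfloor>x / s\<rfloor>, \<lfloor>c / s\<rfloor>)"
        by (auto simp: I_def \<kappa>_def)
      obtain f where f: "f \<in> F" using F0 by blast
      have "\<bar>c * f\<bar> \<le> n * R"
        using xc(1) F(2)[OF f] pos by (auto simp: abs_mult P_def intro!: mult_mono)
      moreover have "x + c * f \<in> {0..1}" using xc(1) f F(1) unfolding P_def by blast
      moreover have "\<bar>c\<bar> \<le> n" "0 \<le> n * R" using xc(1) pos by (auto simp: P_def)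
      ultimately have "x \<in> {-(n + n * R)..n + n * R}" "c \<in> {-(n + n * R)..n + n * R}"
        using pos by (auto simp: abs_le_iff)
      then show "i \<in> ((\<lambda>x. \<lfloor>x / s\<rfloor>) ` {-(n + n * R)..n + n * R}) \<times>
                   ((\<lambda>x. \<lfloor>x / s\<rfloor>) ` {-(n + n * R)..n + n * R})" using xc(2) by blast
    qed
    have nR: "n + n * R \<ge> 0" using pos by simp
    note cf = card_floor_divide_le[OF s nR]
    have finI: "finite I" using sub cf(1) by (rule_tac finite_subset) auto
    have I0: "I \<noteq> {}" using False by (simp add: I_def)
    have "real (card I) \<le> real (card (((\<lambda>x. \<lfloor>x / s\<rfloor>) ` {-(n + n * R)..n + n * R}) \<times>
                   ((\<lambda>x. \<lfloor>x / s\<rfloor>) ` {-(n + n * R)..n + n * R})))"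
      using sub cf(1) by (intro of_nat_mono card_mono) auto
    also have "\<dots> \<le> (2 * (n + n * R) / s + 2) * (2 * (n + n * R) / s + 2)"
      unfolding card_cartesian_product of_nat_mult
      using cf(2) by (intro mult_mono) auto
    also have "\<dots> \<le> (B / \<eta>) * (B / \<eta>)"
    proof -
      \<comment> \<open>The choice of \<open>B\<close> comes from here:
        \<open>1 / s = (1 + R) / \<eta>\<close>, and \<open>2 \<le> 2 / \<eta>\<close> because
        \<open>\<eta> \<le> 1\<close>.\<close>
      have "2 * (n + n * R) / s + 2 \<le> B / \<eta>"
        using pos by (simp add: s_def B_def field_simps)
      moreover have "0 \<le> 2 * (n + n * R) / s + 2" using nR s by simp
      ultimately show ?thesis by (intro mult_mono) linarith+
    qed
    finally have cardI: "real (card I) \<le> (B / \<eta>) * (B / \<eta>)" .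
    have "real (card I) > 0" using I0 finI by (simp add: card_gt_0_iff)
    then have "ln (real (card I)) \<le> ln ((B / \<eta>) * (B / \<eta>))" using cardI by simp
    also have "\<dots> = 2 * ln (B / \<eta>)" using B1 pos by (subst ln_mult) auto
    finally have lnI: "ln (real (card I)) \<le> 2 * ln (B / \<eta>)" .
    have V: "finite V" "V \<noteq> {}" using pos by (auto simp: V_def)
    have "real (card V) \<le> 1 / \<eta> + 1" using pos by (simp add: V_def)
    also have "\<dots> \<le> 2 / \<eta>" using pos by (simp add: field_simps)
    finally have cardV: "real (card V) * \<eta> \<le> 2" using pos by (simp add: field_simps)
    have C: "C i \<subseteq> V \<and> k \<le> real (card (C i))" if "i \<in> I" for i
    proof -
      obtain x c where xc: "rep i = (x, c)" by (metis surj_pair)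
      with rep[OF that] have P: "(x, c) \<in> P" by simp
      have "\<lfloor>(x + c * f) / \<eta>\<rfloor> \<in> V" if "f \<in> F" for f
      proof -
        have "x + c * f \<in> {0..1}" using P that F(1) unfolding P_def by blast
        then show ?thesis using pos by (auto simp: V_def intro!: floor_mono divide_right_mono)
      qed
      then show ?thesis using P cells by (auto simp: C_def xc P_def)
    qed
    have "\<exists>T\<subseteq>V. real (card T) \<le> card V * ln (card I) / k + 2 \<and> (\<forall>i\<in>I. C i \<inter> T \<noteq> {})"
      using V finI I0 pos(5) C by (rule hitting_set_exists)
    then obtain T where T: "T \<subseteq> V" "real (card T) \<le> card V * ln (card I) / k + 2"
      "\<And>i. i \<in> I \<Longrightarrow> C i \<inter> T \<noteq> {}" by metis
    \<comment> \<open>Each chosen cell is widened by one cell on both sides, which absorbs the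
      passage from a representative to any copy in its class.\<close>
    define G where "G = (\<Union>t\<in>T. {of_int t * \<eta> - \<eta> <..< of_int t * \<eta> + 2 * \<eta>})"
    have finT: "finite T" using T(1) V(1) finite_subset by blast
    have "emeasure lebesgue G \<le>
        (\<Sum>t\<in>T. emeasure lebesgue {of_int t * \<eta> - \<eta> <..< of_int t * \<eta> + 2 * \<eta>})"
      unfolding G_def using finT by (intro emeasure_subadditive_finite) auto
    also have "\<dots> = (\<Sum>t\<in>T. ennreal (3 * \<eta>))"
      using pos by (intro sum.cong refl) simp
    also have "\<dots> = ennreal (card T * (3 * \<eta>))"
      using pos by (simp add: ennreal_of_nat_eq_real_of_nat ennreal_mult)
    \<comment> \<open>The 12 is the product of the interval length \<open>3 * \<eta>\<close>, the
      bound 2 for \<open>card V * \<eta>\<close> and the exponent 2 in the bound for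
      \<open>card I\<close>. The term \<open>6 * \<eta>\<close> is the measure contributed by the
      additive 2 in the bound for \<open>card T\<close>.\<close>
    also have "\<dots> \<le> ennreal (6 * \<eta> + 12 * ln (B / \<eta>) / k)"
    proof (rule ennreal_leI)
      have "card T * (3 * \<eta>) \<le> (card V * ln (card I) / k + 2) * (3 * \<eta>)"
        using T(2) pos by (intro mult_right_mono) auto
      also have "\<dots> = 6 * \<eta> + 3 * ((card V * \<eta>) * ln (card I)) / k"
        by (simp add: algebra_simps)
      also have "\<dots> \<le> 6 * \<eta> + 12 * ln (B / \<eta>) / k"
      proof -
        have "(card V * \<eta>) * ln (card I) \<le> 2 * (2 * ln (B / \<eta>))"
          using cardV lnI pos \<open>real (card I) > 0\<close> by (intro mult_mono) auto
        then have "3 * ((card V * \<eta>) * ln (card I)) \<le> 12 * ln (B / \<eta>)" by linarith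
        from divide_right_mono[OF this less_imp_le[OF pos(5)]] show ?thesis
          by (rule add_left_mono)
      qed
      finally show "card T * (3 * \<eta>) \<le> 6 * \<eta> + 12 * ln (B / \<eta>) / k" .
    qed
    finally have meas: "emeasure lebesgue G \<le> ennreal (6 * \<eta> + 12 * ln (B / \<eta>) / k)" .
    have hit: "\<exists>e\<in>E. x + c * e \<in> G"
      if xc: "1 / n \<le> \<bar>c\<bar>" "\<bar>c\<bar> \<le> n" "(\<lambda>e. x + c * e) ` E \<subseteq> {0..1}" for x c
    proof -
      have "(x, c) \<in> P" using xc by (simp add: P_def)
      then have i: "\<kappa> (x, c) \<in> I" by (simp add: I_def)
      obtain x' c' where r: "rep (\<kappa> (x, c)) = (x', c')" by (metis surj_pair)
      with rep[OF i] have "\<lfloor>x / s\<rfloor> = \<lfloor>x' / s\<rfloor>" "\<lfloor>c / s\<rfloor> = \<lfloor>c' / s\<rfloor>" by (auto simp: \<kappa>_def)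
      then have "\<bar>x / s - x' / s\<bar> < 1" "\<bar>c / s - c' / s\<bar> < 1" by linarith+
      then have close: "\<bar>x - x'\<bar> < s" "\<bar>c - c'\<bar> < s"
        using s by (simp_all add: diff_divide_distrib[symmetric])
      obtain f t where f: "f \<in> F" "t \<in> T" "t = \<lfloor>(x' + c' * f) / \<eta>\<rfloor>"
        using T(3)[OF i] unfolding C_def r by blast
      have "of_int t \<le> (x' + c' * f) / \<eta>" "(x' + c' * f) / \<eta> < of_int t + 1"
        unfolding f(3) by (rule of_int_floor_le, rule real_of_int_floor_add_one_gt)
      then have "of_int t * \<eta> \<le> x' + c' * f" "x' + c' * f < of_int t * \<eta> + \<eta>"
        using pos(3) by (simp_all add: pos_le_divide_eq pos_divide_less_eq distrib_right)
      moreover have "\<bar>(c - c') * f\<bar> \<le> s * R"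
        unfolding abs_mult using close F(2)[OF f(1)] s by (intro mult_mono) auto
      then have "c * f - c' * f \<le> s * R" "c' * f - c * f \<le> s * R"
        unfolding abs_le_iff left_diff_distrib by simp_all
      moreover have "x - x' < s" "x' - x < s" using close(1) by (simp_all add: abs_less_iff)
      moreover have "s * (1 + R) = \<eta>" using pos(2) by (simp add: s_def)
      then have "s + s * R = \<eta>" by (simp only: distrib_left mult_1_right)
      ultimately have "x + c * f \<in> {of_int t * \<eta> - \<eta> <..< of_int t * \<eta> + 2 * \<eta>}"
        unfolding greaterThanLessThan_iff by linarith
      then show ?thesis using f(1,2) F(1) unfolding G_def by blast
    qed
    show ?thesis using meas hit by (intro exI[of _ G]) (auto simp: G_def)
  qed
qed

section \<open>From hitting sets to failure of universality\<close>

text \<open>The ranges \<open>1 / n \<le> \<bar>c\<bar> \<le> n\<close> exhaust all nonzero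
  \<open>c\<close>. With one hitting set for each range and measures summing to at most 1/2, the
  rest \<open>L\<close> of the unit interval has positive measure, and a copy inside
  \<open>L\<close> would have to meet one of the removed sets.\<close>

lemma not_measure_universalI:
  assumes G: "\<And>(n::nat) \<epsilon>::real. n \<ge> 1 \<Longrightarrow> \<epsilon> > 0 \<Longrightarrow>
     \<exists>G. open G \<and> emeasure lebesgue G \<le> ennreal \<epsilon> \<and>
        (\<forall>x c. 1 / real n \<le> \<bar>c\<bar> \<longrightarrow> \<bar>c\<bar> \<le> real n \<longrightarrow> (\<lambda>e. x + c * e) ` E \<subseteq> {0..1} \<longrightarrow>
              (\<exists>e\<in>E. x + c * e \<in> G))"
  shows "\<not> measure_universal E"
proof
  assume U: "measure_universal E"
  have "\<forall>n. \<exists>G. open G \<and> emeasure lebesgue G \<le> ennreal ((1/2) * (1/2) ^ Suc n) \<and>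
        (\<forall>x c. 1 / real (Suc n) \<le> \<bar>c\<bar> \<longrightarrow> \<bar>c\<bar> \<le> real (Suc n) \<longrightarrow> (\<lambda>e. x + c * e) ` E \<subseteq> {0..1} \<longrightarrow>
              (\<exists>e\<in>E. x + c * e \<in> G))"
    by (intro allI G) auto
  from choice[OF this] obtain G where open_G: "\<And>n. open (G n)"
    and meas_G: "\<And>n. emeasure lebesgue (G n) \<le> ennreal ((1/2) * (1/2) ^ Suc n)"
    and hit: "\<And>n x c. 1 / real (Suc n) \<le> \<bar>c\<bar> \<Longrightarrow> \<bar>c\<bar> \<le> real (Suc n) \<Longrightarrow>
       (\<lambda>e. x + c * e) ` E \<subseteq> {0..1} \<Longrightarrow> (\<exists>e\<in>E. x + c * e \<in> G n)"
    by blast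
  define L where "L = {0..1} - (\<Union>n. G n)"
  have GL: "G n \<in> sets lebesgue" for n using open_G[of n] by auto
  have L: "L \<in> sets lebesgue" unfolding L_def using GL by auto
  have "emeasure lebesgue (\<Union>n. G n) \<le> (\<Sum>n. emeasure lebesgue (G n))"
    using GL by (intro emeasure_subadditive_countably) auto
  also have "\<dots> \<le> (\<Sum>n. ennreal ((1/2) * (1/2) ^ Suc n))"
    using meas_G by (intro suminf_le) auto
  also have "\<dots> = ennreal (1/2)"
    using sums_mult[OF power_half_series, of "1/2"] by (intro suminf_ennreal_eq) auto
  finally have Gu: "emeasure lebesgue (\<Union>n. G n) \<le> ennreal (1/2)" .
  have "emeasure lebesgue L > 0"
  proof (rule ccontr)
    assume "\<not> ?thesis"
    then have L0: "emeasure lebesgue L = 0" by (simp add: zero_less_iff_neq_zero)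
    have "ennreal 1 = emeasure lebesgue {0..1::real}" by simp
    also have "\<dots> \<le> emeasure lebesgue (L \<union> (\<Union>n. G n))"
      using L GL by (intro emeasure_mono) (auto simp: L_def)
    also have "\<dots> \<le> emeasure lebesgue L + emeasure lebesgue (\<Union>n. G n)"
      using L GL by (intro emeasure_subadditive) auto
    also have "\<dots> \<le> ennreal (1/2)" using L0 Gu by simp
    finally show False by (subst (asm) ennreal_le_iff) auto
  qed
  then obtain x c where xc: "c \<noteq> 0" "(\<lambda>e. x + c * e) ` E \<subseteq> L"
    using U L unfolding measure_universal_def by blast
  obtain n :: nat where n: "max \<bar>c\<bar> (1 / \<bar>c\<bar>) < real n" using reals_Archimedean2 by blast
  have "\<bar>c\<bar> \<le> real (Suc n)" "1 / \<bar>c\<bar> \<le> real (Suc n)" using n by auto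
  then have "1 / real (Suc n) \<le> \<bar>c\<bar>" using xc(1) by (simp add: field_simps)
  with hit[of n c x] \<open>\<bar>c\<bar> \<le> real (Suc n)\<close> xc(2) show False by (auto simp: L_def)
qed

section \<open>Counting the cells met by a sumset\<close>

text \<open>A set added to a union of \<open>i\<close> earlier ones shares at most \<open>i\<close>
  points with it, so it contributes at least \<open>m - i\<close> new ones. The losses 0 + 1 + ...
  stay below half the square of the number of sets.\<close>

lemma card_UN_ge_if_almost_disjoint:
  assumes "finite A" "\<And>a. a \<in> A \<Longrightarrow> finite (X a) \<and> card (X a) = m"
    and "\<And>a b. a \<in> A \<Longrightarrow> b \<in> A \<Longrightarrow> a \<noteq> b \<Longrightarrow> card (X a \<inter> X b) \<le> 1"
  shows "real (card (\<Union>a\<in>A. X a)) \<ge> real (card A) * m - (real (card A))\<^sup>2 / 2"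
  using assms
proof (induction A rule: finite_induct)
  case empty
  then show ?case by simp
next
  case (insert a A)
  have fin: "finite (X a)" "finite (\<Union>b\<in>A. X b)" using insert by auto
  have "card (X a \<inter> (\<Union>b\<in>A. X b)) = card (\<Union>b\<in>A. X a \<inter> X b)" by (simp only: Int_UN_distrib)
  also have "\<dots> \<le> (\<Sum>b\<in>A. card (X a \<inter> X b))" using insert(1) by (rule card_UN_le)
  also have "\<dots> \<le> (\<Sum>b\<in>A. 1)" using insert by (intro sum_mono) auto
  finally have "card (X a \<inter> (\<Union>b\<in>A. X b)) \<le> card A" by simp
  moreover have "card (X a) + card (\<Union>b\<in>A. X b) =
      card (X a \<union> (\<Union>b\<in>A. X b)) + card (X a \<inter> (\<Union>b\<in>A. X b))"
    using fin by (rule card_Un_Int)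
  moreover have "card (X a) = m" using insert by simp
  ultimately have "real m + real (card (\<Union>b\<in>A. X b)) \<le> card (\<Union>b\<in>insert a A. X b) + real (card A)"
    by simp
  moreover have "real (card A) * m - (real (card A))\<^sup>2 / 2 \<le> real (card (\<Union>b\<in>A. X b))"
    using insert by auto
  ultimately show ?case using insert(1,2) by (simp add: power2_eq_square field_simps)
qed

text \<open>Two labels common to the translates of \<open>D\<close> by \<open>a\<close> and
  \<open>b\<close> give differences \<open>d1 - d1'\<close> and \<open>d2 - d2'\<close> that both
  lie within \<open>\<delta>\<close> of \<open>b - a\<close>. Then \<open>diff\<close> yields
  \<open>d1 = d2\<close>, so distinct translates share at most one label. As
  \<open>card A \<le> card D\<close>, the loss from overlaps is at most half of
  \<open>card A * card D\<close>.\<close>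

lemma card_cells_sumset_ge:
  fixes A D :: "real set" and g :: "real \<Rightarrow> int"
  assumes fin: "finite A" "finite D" "card A \<le> card D"
    and g: "\<And>s s'. g s = g s' \<Longrightarrow> \<bar>s - s'\<bar> < \<delta>"
    and A: "\<And>a a'. a \<in> A \<Longrightarrow> a' \<in> A \<Longrightarrow> a \<noteq> a' \<Longrightarrow> \<delta> \<le> \<bar>a - a'\<bar>"
    and D: "\<And>d d'. d \<in> D \<Longrightarrow> d' \<in> D \<Longrightarrow> d \<noteq> d' \<Longrightarrow> \<delta> \<le> \<bar>d - d'\<bar>"
    and diff: "\<And>d1 d1' d2 d2'. {d1, d1', d2, d2'} \<subseteq> D \<Longrightarrow> d1 \<noteq> d1' \<Longrightarrow> d2 \<noteq> d2' \<Longrightarrow>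
           \<bar>(d1 - d1') - (d2 - d2')\<bar> < 2 * \<delta> \<Longrightarrow> d1 = d2"
  shows "real (card A * card D) / 2 \<le> real (card (g ` {a + d |a d. a \<in> A \<and> d \<in> D}))"
proof -
  define X where "X a = (\<lambda>d. g (a + d)) ` D" for a
  have 1: "finite (X a) \<and> card (X a) = card D" for a
  proof -
    have "inj_on (\<lambda>d. g (a + d)) D"
    proof (rule inj_onI, rule ccontr)
      fix d d' assume dd: "d \<in> D" "d' \<in> D" "g (a + d) = g (a + d')" "d \<noteq> d'"
      then show False using g[OF dd(3)] D[OF dd(1,2,4)] by simp
    qed
    then show ?thesis using fin by (simp add: X_def card_image)
  qed
  have 2: "card (X a \<inter> X b) \<le> 1" if ab: "a \<in> A" "b \<in> A" "a \<noteq> b" for a b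
  proof -
    have "u = v" if uv: "u \<in> X a \<inter> X b" "v \<in> X a \<inter> X b" for u v
    proof -
      obtain d1 d1' d2 d2' where d: "d1 \<in> D" "d1' \<in> D" "d2 \<in> D" "d2' \<in> D"
        "u = g (a + d1)" "u = g (b + d1')" "v = g (a + d2)" "v = g (b + d2')"
        using uv unfolding X_def by blast
      have *: "\<bar>(a + d1) - (b + d1')\<bar> < \<delta>" "\<bar>(a + d2) - (b + d2')\<bar> < \<delta>"
        using g d by metis+
      \<comment> \<open>Equality in either pair would put \<open>a\<close> and \<open>b\<close>
        closer together than \<open>\<delta>\<close>.\<close>
      then have "d1 \<noteq> d1'" "d2 \<noteq> d2'" using A[OF ab] by auto
      moreover have "\<bar>(d1 - d1') - (d2 - d2')\<bar> < 2 * \<delta>" using * by linarith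
      ultimately have "d1 = d2" using diff d(1-4) by blast
      then show ?thesis using d by simp
    qed
    moreover have "finite (X a \<inter> X b)" using 1 by blast
    ultimately show ?thesis by (simp add: card_le_Suc0_iff_eq)
  qed
  have "(real (card A))\<^sup>2 \<le> real (card A) * card D"
    unfolding power2_eq_square using fin(3) by (intro mult_left_mono) auto
  then have "real (card A * card D) / 2 \<le> real (card A) * card D - (real (card A))\<^sup>2 / 2"
    by simp
  also have "\<dots> \<le> real (card (\<Union>a\<in>A. X a))"
    using fin(1) 1 2 by (intro card_UN_ge_if_almost_disjoint) auto
  also have "(\<Union>a\<in>A. X a) = g ` {a + d |a d. a \<in> A \<and> d \<in> D}" by (auto simp: X_def)
  finally show ?thesis .
qed

section \<open>Lacunary sequences and their sparse subsequences\<close>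

lemma lacunary_le_power:
  assumes "lacunary q d" "j \<ge> 1"
  shows "d (j + i) \<le> q ^ i * d j"
proof (induction i)
  case (Suc i)
  have "d (Suc (j + i)) \<le> q * d (j + i)" using assms by (simp add: lacunary_def)
  also have "\<dots> \<le> q * (q ^ i * d j)" using Suc assms by (intro mult_left_mono) (auto simp: lacunary_def)
  finally show ?case by simp
qed simp

lemma lacunary_less:
  assumes "lacunary q d" "1 \<le> i" "i < j"
  shows "d j < d i"
proof -
  obtain k where k: "j = i + Suc k" using assms(3) less_iff_Suc_add by auto
  have q: "0 < q" "q < 1" "0 < d i" using assms by (auto simp: lacunary_def)
  then have "q ^ Suc k < 1" by (intro power_Suc_less_one) auto
  then have "q ^ Suc k * d i < 1 * d i" using q by (intro mult_strict_right_mono) auto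
  then show ?thesis using lacunary_le_power[OF assms(1,2), of "Suc k"] k by simp
qed

text \<open>\<open>D\<close> consists of every \<open>m\<close>-th term, starting with
  \<open>d 1\<close>, among the terms that are at least \<open>exp (- W)\<close>. Its ratio is at
  most \<open>q ^ m\<close>, and only the factor \<open>m\<close> is lost in the count.\<close>

lemma lacunary_sparse_subset:
  assumes lac: "lacunary q d" and m: "m \<ge> 1" "q ^ m \<le> 1 / 4"
  shows "\<exists>D. D \<subseteq> d ` {1..} \<and> finite D \<and> counting_fun d W \<le> m * card D \<and>
           (\<forall>x\<in>D. exp (- W) \<le> x) \<and> (\<forall>x\<in>D. \<forall>y\<in>D. y < x \<longrightarrow> y \<le> x / 4)"
proof -
  define H where "H = {j. j \<ge> 1 \<and> d j \<ge> exp (- W)}"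
  have q: "0 < q" "q < 1" using lac by (auto simp: lacunary_def)
  have pos: "d j > 0" if "j \<ge> 1" for j using lac that by (auto simp: lacunary_def)
  have finH: "finite H"
  proof -
    have "(\<lambda>i. q ^ i * d 1) \<longlonglongrightarrow> 0"
      using q by (intro tendsto_mult_left_zero LIMSEQ_power_zero) auto
    then have "\<forall>\<^sub>F i in sequentially. q ^ i * d 1 < exp (- W)" by (rule order_tendstoD) simp
    then obtain N where N: "\<And>i. i \<ge> N \<Longrightarrow> q ^ i * d 1 < exp (- W)"
      by (auto simp: eventually_sequentially)
    have "j \<le> N" if "j \<in> H" for j
    proof (rule ccontr)
      assume "\<not> j \<le> N"
      then have "d j \<le> q ^ (j - 1) * d 1" "q ^ (j - 1) * d 1 < exp (- W)"
        using lacunary_le_power[OF lac, of 1 "j - 1"] N[of "j - 1"] by auto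
      then show False using that by (simp add: H_def)
    qed
    then show ?thesis by (auto simp: finite_nat_set_iff_bounded_le)
  qed
  define K where "K = {i. 1 + m * i \<in> H}"
  define D where "D = (\<lambda>i. d (1 + m * i)) ` K"
  have finK: "finite K"
  proof -
    have "inj_on (\<lambda>i. 1 + m * i) K" using m by (auto intro!: inj_onI)
    moreover have "(\<lambda>i. 1 + m * i) ` K \<subseteq> H" by (auto simp: K_def)
    ultimately show ?thesis using finH finite_imageD finite_subset by blast
  qed
  have quarter: "d (1 + m * j) \<le> d (1 + m * i) / 4" if "i < j" for i j
  proof -
    have "m * Suc i \<le> m * j" using that by (intro mult_le_mono) auto
    then have "1 + m * i + m \<le> 1 + m * j" by simp
    then have "d (1 + m * j) \<le> d (1 + m * i + m)"
      using lacunary_less[OF lac, of "1 + m * i + m" "1 + m * j"]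
      by (cases "1 + m * i + m = 1 + m * j") auto
    also have "\<dots> \<le> q ^ m * d (1 + m * i)" by (rule lacunary_le_power[OF lac]) auto
    also have "\<dots> \<le> 1 / 4 * d (1 + m * i)"
      using m pos[of "1 + m * i"] by (intro mult_right_mono) auto
    finally show ?thesis by simp
  qed
  have inj: "inj_on (\<lambda>i. d (1 + m * i)) K"
  proof (rule inj_onI, rule ccontr)
    fix i j assume *: "d (1 + m * i) = d (1 + m * j)" "i \<noteq> j"
    then show False using quarter[of i j] quarter[of j i] pos[of "1 + m * i"] by (cases "i < j") auto
  qed
  \<comment> \<open>The indices from 1 on are cut into blocks of length \<open>m\<close>. As
    \<open>d\<close> decreases, a block that meets \<open>H\<close> has its first index in
    \<open>H\<close>, so that index was selected.\<close>
  have "H \<subseteq> (\<Union>i\<in>K. {1 + m * i..<1 + m * i + m})"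
  proof
    fix j assume j: "j \<in> H"
    define i where "i = (j - 1) div m"
    have "m * i + (j - 1) mod m = j - 1" by (simp add: i_def)
    moreover have "(j - 1) mod m < m" using m by simp
    moreover have "j \<ge> 1" using j by (simp add: H_def)
    ultimately have *: "1 + m * i \<le> j" "j < 1 + m * i + m" by linarith+
    have "d j \<le> d (1 + m * i)"
      using lacunary_less[OF lac, of "1 + m * i" j] * by (cases "1 + m * i = j") auto
    then have "i \<in> K" using j by (auto simp: K_def H_def)
    then show "j \<in> (\<Union>i\<in>K. {1 + m * i..<1 + m * i + m})" using * by auto
  qed
  then have "card H \<le> card (\<Union>i\<in>K. {1 + m * i..<1 + m * i + m})"
    using finK by (intro card_mono) auto
  also have "\<dots> \<le> (\<Sum>i\<in>K. card {1 + m * i..<1 + m * i + m})" using finK by (rule card_UN_le)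
  also have "\<dots> = m * card D" using inj by (simp add: D_def card_image)
  finally have "counting_fun d W \<le> m * card D" by (simp add: counting_fun_def H_def)
  moreover have "\<forall>x\<in>D. \<forall>y\<in>D. y < x \<longrightarrow> y \<le> x / 4"
  proof (intro ballI impI)
    fix x y assume "x \<in> D" "y \<in> D" "y < x"
    then obtain i j where ij: "x = d (1 + m * i)" "y = d (1 + m * j)" by (auto simp: D_def)
    then have "i < j"
      using quarter[of j i] pos[of "1 + m * j"] \<open>y < x\<close> by (cases i j rule: linorder_cases) auto
    then show "y \<le> x / 4" using quarter ij by simp
  qed
  moreover have "D \<subseteq> d ` {1..}" "finite D" "\<forall>x\<in>D. exp (- W) \<le> x"
    using finK by (auto simp: D_def K_def H_def)
  ultimately show ?thesis by blast
qed

text \<open>A positive difference of two elements lies between 3/4 of the larger one and that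
  element itself. Distinct elements are a factor 4 apart, so these ranges are separated by more than
  \<open>w / 2\<close>, and an approximate difference determines its sign and its larger
  element.\<close>

lemma sparse_differences:
  fixes D :: "real set"
  assumes D: "\<forall>x\<in>D. w \<le> x" "\<forall>x\<in>D. \<forall>y\<in>D. y < x \<longrightarrow> y \<le> x / 4" and "w > 0"
  shows "x \<in> D \<Longrightarrow> y \<in> D \<Longrightarrow> x \<noteq> y \<Longrightarrow> w / 4 \<le> \<bar>x - y\<bar>"
    and "{x, x', y, y'} \<subseteq> D \<Longrightarrow> x \<noteq> x' \<Longrightarrow> y \<noteq> y' \<Longrightarrow>
           \<bar>(x - x') - (y - y')\<bar> < 2 * (w / 4) \<Longrightarrow> x = y"
proof -
  have low: "w \<le> x" if "x \<in> D" for x using D that by blast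
  have quarter: "y \<le> x / 4" if "x \<in> D" "y \<in> D" "y < x" for x y using D that by blast
  show "w / 4 \<le> \<bar>x - y\<bar>" if "x \<in> D" "y \<in> D" "x \<noteq> y" for x y
    using that low[of x] low[of y] quarter[of x y] quarter[of y x] \<open>w > 0\<close> by linarith
  show "x = y" if "{x, x', y, y'} \<subseteq> D" "x \<noteq> x'" "y \<noteq> y'"
    "\<bar>(x - x') - (y - y')\<bar> < 2 * (w / 4)" for x x' y y'
  proof -
    have D: "x \<in> D" "x' \<in> D" "y \<in> D" "y' \<in> D" using that(1) by auto
    note l = low[OF D(1)] low[OF D(2)] low[OF D(3)] low[OF D(4)]
    note q = quarter[OF D(1,2)] quarter[OF D(2,1)] quarter[OF D(3,4)] quarter[OF D(4,3)]
      quarter[OF D(1,3)] quarter[OF D(3,1)] quarter[OF D(2,4)] quarter[OF D(4,2)]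
    show ?thesis
    proof (cases "x' < x")
      case True
      with q(1) have "x' \<le> x / 4" by blast
      \<comment> \<open>Differences of opposite sign are too far apart, each being at least 3/4 of
        its larger element in absolute value.\<close>
      have "y' < y"
      proof (rule ccontr)
        assume "\<not> y' < y"
        with q(4) that(3) have "y \<le> y' / 4" by simp
        with \<open>x' \<le> x / 4\<close> show False using l that(4) \<open>w > 0\<close> by linarith
      qed
      with q(3) have "y' \<le> y / 4" by blast
      show ?thesis
      proof (cases x y rule: linorder_cases)
        case less
        with q(6) have "x \<le> y / 4" by blast
        then show ?thesis using \<open>y' \<le> y / 4\<close> l that(4) \<open>w > 0\<close> by linarith
      next
        case greater
        with q(5) have "y \<le> x / 4" by blast
        then show ?thesis using \<open>x' \<le> x / 4\<close> l that(4) \<open>w > 0\<close> by linarith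
      qed
    next
      case False
      with q(2) that(2) have "x \<le> x' / 4" by simp
      have "y < y'"
      proof (rule ccontr)
        assume "\<not> y < y'"
        with q(3) that(3) have "y' \<le> y / 4" by simp
        with \<open>x \<le> x' / 4\<close> show False using l that(4) \<open>w > 0\<close> by linarith
      qed
      with q(4) have "y \<le> y' / 4" by blast
      have "x' = y'"
      proof (cases x' y' rule: linorder_cases)
        case less
        with q(8) have "x' \<le> y' / 4" by blast
        then show ?thesis using \<open>y \<le> y' / 4\<close> l that(4) \<open>w > 0\<close> by linarith
      next
        case greater
        with q(7) have "y' \<le> x' / 4" by blast
        then show ?thesis using \<open>x \<le> x' / 4\<close> l that(4) \<open>w > 0\<close> by linarith
      qed
      \<comment> \<open>Here the larger elements are the subtracted ones. Once they cancel,
        \<open>x\<close> and \<open>y\<close> are closer than distinct elements of \<open>D\<close>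
        can be.\<close>
      then have "\<bar>x - y\<bar> < w / 2" using that(4) by simp
      then show ?thesis using q(5,6) l(1,3) \<open>w > 0\<close> by linarith
    qed
  qed
qed

section \<open>Attainment of the packing number\<close>

text \<open>A separated set has at most one point in each cell of length
  \<open>2 * exp (- W)\<close>, and finitely many such cells cover a bounded set. The cardinalities
  are therefore bounded, and \<open>Max\<close> is attained.\<close>

lemma packing_fun_attained:
  assumes "bounded Q"
  shows "\<exists>U. U \<subseteq> S \<inter> Q \<and> finite U \<and> card U = packing_fun S Q W \<and>
            (\<forall>u\<in>U. \<forall>v\<in>U. u \<noteq> v \<longrightarrow> \<bar>u - v\<bar> \<ge> 2 * exp (- W))"
proof -
  let ?P = "\<lambda>U. U \<subseteq> S \<inter> Q \<and> finite U \<and> (\<forall>u\<in>U. \<forall>v\<in>U. u \<noteq> v \<longrightarrow> \<bar>u - v\<bar> \<ge> 2 * exp (- W))"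
  obtain b where b: "b > 0" "\<And>x. x \<in> Q \<Longrightarrow> \<bar>x\<bar> \<le> b" using assms by (auto simp: bounded_pos)
  define X where "X = (\<lambda>x. \<lfloor>x / (2 * exp (- W))\<rfloor>) ` {-b..b}"
  have finX: "finite X" unfolding X_def using b by (intro card_floor_divide_le) auto
  have "card U \<le> card X" if U: "?P U" for U
  proof (rule card_inj_on_le[OF _ _ finX])
    show "inj_on (\<lambda>x. \<lfloor>x / (2 * exp (- W))\<rfloor>) U"
    proof (rule inj_onI, rule ccontr)
      fix u v assume uv: "u \<in> U" "v \<in> U" "\<lfloor>u / (2 * exp (- W))\<rfloor> = \<lfloor>v / (2 * exp (- W))\<rfloor>" "u \<noteq> v"
      then have "\<bar>u / (2 * exp (- W)) - v / (2 * exp (- W))\<bar> < 1" by linarith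
      then have "\<bar>u - v\<bar> < 2 * exp (- W)" by (simp add: diff_divide_distrib[symmetric])
      then show False using U uv by force
    qed
    show "(\<lambda>x. \<lfloor>x / (2 * exp (- W))\<rfloor>) ` U \<subseteq> X"
      unfolding X_def
    proof (rule image_mono, rule subsetI)
      fix u assume "u \<in> U"
      then have "\<bar>u\<bar> \<le> b" using U b(2) by blast
      then show "u \<in> {-b..b}" by auto
    qed
  qed
  then have "{card U |U. ?P U} \<subseteq> {..card X}" by blast
  then have "finite {card U |U. ?P U}" by (rule finite_subset) simp
  moreover have "?P {}" by simp
  then have "{card U |U. ?P U} \<noteq> {}" by blast
  ultimately have "packing_fun S Q W \<in> {card U |U. ?P U}"
    unfolding packing_fun_def by (rule Max_in)
  then obtain U where "packing_fun S Q W = card U" "?P U" by blast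
  then show ?thesis by (intro exI[of _ U]) simp
qed

section \<open>Choice of the scale and conclusion\<close>

text \<open>The factor \<open>\<sigma>\<close> treats sums and differences at once: multiplication
  by it preserves distances, so the separation properties of the sparse subsequence survive.\<close>

lemma not_measure_universal_signed:
  fixes S1 S2 Q0 :: "real set" and d :: "nat \<Rightarrow> real" and q \<sigma> :: real
  assumes lac: "lacunary q d"
    and S2: "\<forall>j\<ge>1. d j \<in> S2"
    and bdd: "bounded Q0"
    and lim: "Limsup at_top
           (\<lambda>W::real. ereal (real (min (packing_fun S1 Q0 W) (counting_fun d W))
                              * real (counting_fun d W) / W)) = \<infinity>"
    and \<sigma>: "\<bar>\<sigma>\<bar> = 1"
  shows "\<not> measure_universal {s1 + \<sigma> * s2 |s1 s2. s1 \<in> S1 \<and> s2 \<in> S2}"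
proof (rule not_measure_universalI)
  fix n :: nat and \<epsilon> :: real
  assume n: "n \<ge> 1" and \<epsilon>: "\<epsilon> > 0"
  let ?E = "{s1 + \<sigma> * s2 |s1 s2. s1 \<in> S1 \<and> s2 \<in> S2}"
  have q: "0 < q" "q < 1" using lac by (auto simp: lacunary_def)
  have pos: "d j > 0" if "j \<ge> 1" for j using lac that by (auto simp: lacunary_def)
  obtain m where m: "m \<ge> 1" "q ^ m \<le> 1 / 4"
  proof -
    obtain m where "q ^ m < 1 / 4" using real_arch_pow_inv[of "1/4" q] q by auto
    moreover have "q ^ Suc m \<le> q ^ m" using q by (intro power_decreasing) auto
    ultimately show ?thesis by (intro that[of "Suc m"]) auto
  qed
  obtain b where b: "b > 0" "\<And>x. x \<in> Q0 \<Longrightarrow> \<bar>x\<bar> \<le> b" using bdd by (auto simp: bounded_pos)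
  \<comment> \<open>As \<open>d 1\<close> is the largest term, \<open>R\<close> bounds every
    \<open>a + \<sigma> * d j\<close> with \<open>a\<close> in \<open>Q0\<close>. Neither
    \<open>R\<close> nor \<open>B\<close> depends on the scale \<open>W\<close>, which is chosen
    after them.\<close>
  define R where "R = b + d 1"
  have R: "R \<ge> 0" using b pos[of 1] by (simp add: R_def)
  define B where "B = 2 * (n + n * R) * (1 + R) + 2"
  have B: "B \<ge> 1" using R by (simp add: B_def)
  \<comment> \<open>The logarithm ensures \<open>ln (B / \<eta>) \<le> 2 * W\<close>, and
    \<open>12 / \<epsilon>\<close> ensures \<open>6 * \<eta> \<le> \<epsilon> / 2\<close>.\<close>
  define W0 where "W0 = max (max 1 (ln (4 * n * B))) (12 / \<epsilon>)"
  \<comment> \<open>Thinning to \<open>A\<close> and \<open>D\<close> costs \<open>m\<close> in each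
    factor, and \<open>k\<close> carries a factor 1/2. Thus \<open>K * W < 2 * m^2 * k\<close>, that
    is \<open>48 * W < \<epsilon> * k\<close>, which puts \<open>24 * W / k\<close> below
    \<open>\<epsilon> / 2\<close>.\<close>
  define K where "K = 96 * (real m)\<^sup>2 / \<epsilon>"
  obtain W where W: "W \<ge> W0"
    "real (min (packing_fun S1 Q0 W) (counting_fun d W)) * real (counting_fun d W) / W > K"
  proof (rule ccontr)
    assume "\<not> thesis"
    then have "\<forall>W\<ge>W0. real (min (packing_fun S1 Q0 W) (counting_fun d W)) * real (counting_fun d W) / W \<le> K"
      using that by force
    then have "Limsup at_top
           (\<lambda>W::real. ereal (real (min (packing_fun S1 Q0 W) (counting_fun d W))
                              * real (counting_fun d W) / W)) \<le> ereal K"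
      by (intro Limsup_bounded) (auto simp: eventually_at_top_linorder)
    then show False using lim by simp
  qed
  have W1: "W \<ge> 1" "W \<ge> ln (4 * n * B)" "W \<ge> 12 / \<epsilon>" using W(1) by (auto simp: W0_def)
  define w where "w = exp (- W)"
  \<comment> \<open>For \<open>\<bar>c\<bar> \<ge> 1 / n\<close>, two points whose images share a
    cell are closer than \<open>n * \<eta> = w / 4\<close>, the separation used for the sumset
    count.\<close>
  define \<eta> where "\<eta> = w / (4 * n)"
  have w: "w > 0" "w < 1" using W1 by (auto simp: w_def)
  have \<eta>: "\<eta> > 0" "\<eta> \<le> 1" using w n by (auto simp: \<eta>_def field_simps)
  obtain U where U: "U \<subseteq> S1 \<inter> Q0" "finite U" "card U = packing_fun S1 Q0 W"
    "\<And>u v. u \<in> U \<Longrightarrow> v \<in> U \<Longrightarrow> u \<noteq> v \<Longrightarrow> \<bar>u - v\<bar> \<ge> 2 * w"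
    using packing_fun_attained[OF bdd] unfolding w_def by metis
  obtain D0 where D0: "D0 \<subseteq> d ` {1..}" "finite D0" "counting_fun d W \<le> m * card D0"
    "\<forall>x\<in>D0. w \<le> x" "\<forall>x\<in>D0. \<forall>y\<in>D0. y < x \<longrightarrow> y \<le> x / 4"
    using lacunary_sparse_subset[OF lac m, of W] unfolding w_def by blast
  \<comment> \<open>Cutting \<open>U\<close> down to at most \<open>card D0\<close> points provides
    the inequality \<open>card A \<le> card D\<close> needed to count cells.\<close>
  obtain A where A: "A \<subseteq> U" "card A = min (card U) (card D0)"
    using obtain_subset_with_card_n[of "min (card U) (card D0)" U] by auto
  have finA: "finite A" using A(1) U(2) finite_subset by blast
  define D where "D = (*) \<sigma> ` D0"
  have \<sigma>0: "\<sigma> \<noteq> 0" using \<sigma> by auto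
  have cardD: "card D = card D0" "finite D"
    unfolding D_def using D0(2) \<sigma>0 by (auto intro!: card_image inj_onI)
  define F where "F = {a + e |a e. a \<in> A \<and> e \<in> D}"
  define k where "k = real (card A * card D) / 2"
  have "real (min (packing_fun S1 Q0 W) (counting_fun d W)) \<le> m * real (card A)"
  proof -
    have "min (packing_fun S1 Q0 W) (counting_fun d W) \<le> m * min (card U) (card D0)"
      using D0(3) U(3) m(1) by (cases "card U \<le> card D0") (auto simp: min_le_iff_disj)
    then show ?thesis using A(2) by (metis of_nat_le_iff of_nat_mult)
  qed
  moreover have "real (counting_fun d W) \<le> m * real (card D)"
    using D0(3) cardD by (metis of_nat_le_iff of_nat_mult)
  ultimately have "real (min (packing_fun S1 Q0 W) (counting_fun d W)) * real (counting_fun d W)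
      \<le> (m * real (card A)) * (m * real (card D))" by (intro mult_mono) auto
  also have "\<dots> = 2 * (real m)\<^sup>2 * k" by (simp add: k_def power2_eq_square)
  finally have "K * W < 2 * (real m)\<^sup>2 * k" using W(2) W1 by (simp add: field_simps)
  then have kW: "48 * W < \<epsilon> * k"
    using m(1) \<epsilon> by (simp add: K_def field_simps)
  have k: "k > 0" using kW W1 \<epsilon> by (smt (verit) mult_nonneg_nonpos)
  have cells: "k \<le> real (card ((\<lambda>f. \<lfloor>(x + c * f) / \<eta>\<rfloor>) ` F))"
    if c: "1 / real n \<le> \<bar>c\<bar>" "\<bar>c\<bar> \<le> real n" for x c
    unfolding k_def F_def
  proof (rule card_cells_sumset_ge[where \<delta> = "w / 4"])
    show "card A \<le> card D" using A(2) cardD by simp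
    show "\<bar>s - s'\<bar> < w / 4" if "\<lfloor>(x + c * s) / \<eta>\<rfloor> = \<lfloor>(x + c * s') / \<eta>\<rfloor>" for s s'
    proof -
      have "\<bar>(x + c * s) / \<eta> - (x + c * s') / \<eta>\<bar> < 1" using that by linarith
      then have "\<bar>c * (s - s')\<bar> < \<eta>"
        using \<eta> by (simp add: diff_divide_distrib[symmetric] algebra_simps)
      moreover have "1 / real n * \<bar>s - s'\<bar> \<le> \<bar>c * (s - s')\<bar>"
        unfolding abs_mult using c by (intro mult_right_mono) auto
      ultimately show ?thesis using n by (simp add: \<eta>_def field_simps)
    qed
    show "w / 4 \<le> \<bar>a - a'\<bar>" if "a \<in> A" "a' \<in> A" "a \<noteq> a'" for a a'
      using U(4)[of a a'] that A(1) w by force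
    have scale: "\<bar>\<sigma> * x - \<sigma> * y\<bar> = \<bar>x - y\<bar>" for x y
      using \<sigma> by (metis abs_mult mult_1 right_diff_distrib)
    note sp = sparse_differences[OF D0(4,5) w(1)]
    show "w / 4 \<le> \<bar>e - e'\<bar>" if e: "e \<in> D" "e' \<in> D" "e \<noteq> e'" for e e'
      using e sp(1) by (auto simp: D_def scale)
    show "e1 = e2" if e: "{e1, e1', e2, e2'} \<subseteq> D" "e1 \<noteq> e1'" "e2 \<noteq> e2'"
      "\<bar>(e1 - e1') - (e2 - e2')\<bar> < 2 * (w / 4)" for e1 e1' e2 e2'
    proof -
      obtain x x' y y' where xy: "e1 = \<sigma> * x" "e1' = \<sigma> * x'" "e2 = \<sigma> * y" "e2' = \<sigma> * y'"
        and D0': "{x, x', y, y'} \<subseteq> D0" using e(1) by (auto simp: D_def)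
      have "\<bar>(x - x') - (y - y')\<bar> < 2 * (w / 4)"
        using e(4) scale[of "x - x'" "y - y'"] by (simp add: xy right_diff_distrib)
      then show ?thesis using sp(2)[OF D0'] e(2,3) xy by auto
    qed
  qed (use finA cardD in auto)
  have F_elim: "\<exists>a j. f = a + \<sigma> * d j \<and> a \<in> A \<and> j \<ge> 1" if f: "f \<in> F" for f
  proof -
    obtain a x where "f = a + \<sigma> * x" "a \<in> A" "x \<in> D0"
      using f unfolding F_def D_def by blast
    moreover from \<open>x \<in> D0\<close> obtain j where "x = d j" "j \<ge> 1" using D0(1) by auto
    ultimately show ?thesis by blast
  qed
  have FE: "F \<subseteq> ?E"
  proof
    fix f assume "f \<in> F"
    then obtain a j where f: "f = a + \<sigma> * d j" "a \<in> A" "j \<ge> 1" using F_elim by blast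
    then have "a \<in> S1" "d j \<in> S2" using A(1) U(1) S2 by auto
    then show "f \<in> ?E" using f(1) by blast
  qed
  have FR: "\<bar>f\<bar> \<le> R" if "f \<in> F" for f
  proof -
    obtain a j where f: "f = a + \<sigma> * d j" "a \<in> A" "j \<ge> 1" using F_elim \<open>f \<in> F\<close> by blast
    have "d j \<le> d 1" using lacunary_less[OF lac, of 1 j] f(3) by (cases "j = 1") auto
    then have "\<bar>\<sigma> * d j\<bar> \<le> d 1" using \<sigma> pos[OF f(3)] by (simp add: abs_mult)
    moreover have "\<bar>a\<bar> \<le> b" using f(2) A(1) U(1) b(2) by blast
    ultimately show ?thesis unfolding f(1) R_def by linarith
  qed
  have n1: "real n \<ge> 1" using n by simp
  \<comment> \<open>Each summand is at most \<open>\<epsilon> / 2\<close>: the logarithm is at most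
    \<open>2 * W\<close>, and \<open>\<eta> \<le> exp (- W) \<le> 1 / W\<close>.\<close>
  have "6 * \<eta> + 12 * ln (B / \<eta>) / k \<le> \<epsilon>"
  proof -
    have "B / \<eta> = 4 * n * B * exp W" by (simp add: \<eta>_def w_def exp_minus field_simps)
    then have "ln (B / \<eta>) = ln (4 * n * B) + W" using n B by (simp add: ln_mult)
    then have "12 * ln (B / \<eta>) \<le> 24 * W" using W1 by simp
    then have "12 * ln (B / \<eta>) \<le> \<epsilon> / 2 * k" using kW by simp
    then have 1: "12 * ln (B / \<eta>) / k \<le> \<epsilon> / 2" using k by (simp add: field_simps)
    have "\<eta> \<le> w" using n w by (simp add: \<eta>_def field_simps)
    also have "w \<le> 1 / W"
    proof -
      have "W \<le> exp W" using exp_ge_add_one_self[of W] by linarith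
      then show ?thesis using W1 by (simp add: w_def exp_minus field_simps)
    qed
    also have "\<dots> \<le> \<epsilon> / 12" using W1 \<epsilon> by (simp add: field_simps)
    finally show ?thesis using 1 by simp
  qed
  then have small: "ennreal (6 * \<eta> + 12 * ln (B / \<eta>) / k) \<le> ennreal \<epsilon>" by (rule ennreal_leI)
  have "\<exists>G. open G \<and> emeasure lebesgue G \<le> ennreal (6 * \<eta> + 12 * ln (B / \<eta>) / k) \<and>
        (\<forall>x c. 1 / real n \<le> \<bar>c\<bar> \<longrightarrow> \<bar>c\<bar> \<le> real n \<longrightarrow> (\<lambda>e. x + c * e) ` ?E \<subseteq> {0..1} \<longrightarrow>
              (\<exists>e\<in>?E. x + c * e \<in> G))"
    unfolding B_def using FE FR n1 R \<eta> k cells by (rule affine_hitting_set)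
  then show "\<exists>G. open G \<and> emeasure lebesgue G \<le> ennreal \<epsilon> \<and>
        (\<forall>x c. 1 / real n \<le> \<bar>c\<bar> \<longrightarrow> \<bar>c\<bar> \<le> real n \<longrightarrow> (\<lambda>e. x + c * e) ` ?E \<subseteq> {0..1} \<longrightarrow>
              (\<exists>e\<in>?E. x + c * e \<in> G))"
    using small by (meson order_trans)
qed

theorem theorem3:
  fixes S1 S2 Q0 :: "real set" and d :: "nat \<Rightarrow> real" and q :: real
  assumes "lacunary q d"
    and "\<forall>j\<ge>1. d j \<in> S2"
    and "infinite S1"
    and "is_interval Q0" and "bounded Q0"
    and "infinite (S1 \<inter> Q0)"
    and "Limsup at_top
           (\<lambda>W::real. ereal (real (min (packing_fun S1 Q0 W) (counting_fun d W))
                              * real (counting_fun d W) / W)) = \<infinity>"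
  shows "\<not> measure_universal {s1 + s2 |s1 s2. s1 \<in> S1 \<and> s2 \<in> S2} \<and>
         \<not> measure_universal {s1 - s2 |s1 s2. s1 \<in> S1 \<and> s2 \<in> S2}"
  using not_measure_universal_signed[OF assms(1,2,5,7), of 1]
    not_measure_universal_signed[OF assms(1,2,5,7), of "-1"]
  by simp

end
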